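(* Let $1<p<\infty$, let $n\in\mathbb{N}$, and let $V\subseteq W$ be $p$-operator spaces. If $\|w\|_{2,n}=\|w\|_{1,n}$ for all $w\in\mathbb{M}_n(W)$, then the inclusion $\mathcal{T}_n(V)\hookrightarrow\mathcal{T}_n(W)$ is isometric.
   Context: All spaces are complex; $1<p,p'<\infty$ with $1/p+1/p'=1$. For a vector space $X$, $\mathbb{M}_{n,m}(X)$ is the space of $n\times m$ matrices over $X$, $\mathbb{M}_n(X)=\mathbb{M}_{n,n}(X)$, $\mathbb{M}_{n,m}=\mathbb{M}_{n,m}(\mathbb{C})$ and $\mathbb{M}_n=\mathbb{M}_{n,n}$. A $p$-operator space is a Banach space $X$ together with norms $\|\cdot\|_n$ on $\mathbb{M}_n(X)$, $n\ge1$ (with $\|\cdot\|_1$ the norm of $X$), such that, writing $M_n(X)=(\mathbb{M}_n(X),\|\cdot\|_n)$: (1) $\|u\oplus v\|_{n+m}=\max\{\|u\|_n,\|v\|_m\}$ for $u\in M_n(X)$, $v\in M_m(X)$; (2) $\|\alpha u\beta\|_n\le\|\alpha\|\,\|u\|_m\,\|\beta\|$ for $u\in M_m(X)$, $\alpha\in\mathbb{M}_{n,m}$, $\beta\in\mathbb{M}_{m,n}$, where $\|\alpha\|$ is the norm in $\mathcal{B}(\ell_p^m,\ell_p^n)$ and $\|\beta\|$ the norm in $\mathcal{B}(\ell_p^n,\ell_p^m)$. $V\subseteq W$ means that $V$ is a closed subspace of $W$ with the inherited matrix norms. For scalar matrices put $\|\alpha\|_{p'}=\left(\sum_{i,j}|\alpha_{ij}|^{p'}\right)^{1/p'}$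 and $\|\beta\|_p=\left(\sum_{k,l}|\beta_{kl}|^{p}\right)^{1/p}$. For a $p$-operator space $X$ and $v\in\mathbb{M}_n(X)$ define $$\|v\|_{1,n}=\inf\{\|\alpha\|_{p'}\,\|w\|_{M_r(X)}\,\|\beta\|_p:\ r\in\mathbb{N},\ v=\alpha w\beta,\ \alpha\in\mathbb{M}_{n,r},\ \beta\in\mathbb{M}_{r,n},\ w\in M_r(X)\},$$ which is a norm on $\mathbb{M}_n(X)$; $\mathcal{T}_n(X)$ denotes $(\mathbb{M}_n(X),\|\cdot\|_{1,n})$. For $1<q<\infty$ and $r\ge n$, a matrix $\beta\in\mathbb{M}_{r,n}=\mathcal{B}(\ell_q^n,\ell_q^r)$ is $\ell_q$-polar decomposible if $\beta=\tau\beta_0$ for some $\tau\in\mathbb{M}_{r,n}$ that is an isometry $\ell_q^n\to\ell_q^r$ and some $\beta_0\in\mathbb{M}_n$. $\mathbb{M}_{r,n}^{(q)}$ denotes the set of all full rank $\ell_q$-polar decomposible $r\times n$ matrices ($r\ge n$). For $v\in\mathbb{M}_n(X)$ define $$\|v\|_{2,n}=\inf\{\|\alpha\|_{p'}\,\|w\|_{M_r(X)}\,\|\beta\|_p:\ r\in\mathbb{N},\ r\ge n,\ v=\alpha w\beta,\ \alpha^T\in\mathbb{M}_{r,n}^{(p')},\ \beta\in\mathbb{M}_{r,n}^{(p)},\ w\in M_r(X)\},$$ where $\alpha^T$ is the transpose of $\alpha$. *)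

theory Defs
  imports
    "HOL-Analysis.Abstract_Metric_Spaces"
    "Jordan_Normal_Form.DL_Rank"
begin

section \<open>Scalar matrices and \<open>\<ell>\<^sub>p\<close> norms\<close>

definition lp_norm :: "real \<Rightarrow> complex vec \<Rightarrow> real" where
  "lp_norm p x = (\<Sum>i<dim_vec x. cmod (x $ i) powr p) powr (1 / p)"

text \<open>For \<open>A \<in> carrier_mat n m\<close>, the norm of \<open>A\<close> in \<open>\<B>(\<ell>\<^sub>p\<^sup>m, \<ell>\<^sub>p\<^sup>n)\<close>.\<close>

definition lp_opnorm :: "real \<Rightarrow> complex mat \<Rightarrow> real" where
  "lp_opnorm p A =
    (SUP x\<in>{x \<in> carrier_vec (dim_col A). lp_norm p x \<le> 1}. lp_norm p (A *\<^sub>v x))"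

definition entry_norm :: "real \<Rightarrow> complex mat \<Rightarrow> real" where
  "entry_norm q A = (\<Sum>i<dim_row A. \<Sum>j<dim_col A. cmod (A $$ (i, j)) powr q) powr (1 / q)"

definition lp_isometry :: "real \<Rightarrow> nat \<Rightarrow> nat \<Rightarrow> complex mat \<Rightarrow> bool" where
  "lp_isometry q r n \<tau> \<longleftrightarrow>
    \<tau> \<in> carrier_mat r n \<and> (\<forall>x\<in>carrier_vec n. lp_norm q (\<tau> *\<^sub>v x) = lp_norm q x)"

definition lp_polar_decomposable :: "real \<Rightarrow> nat \<Rightarrow> nat \<Rightarrow> complex mat \<Rightarrow> bool" where
  "lp_polar_decomposable q r n \<beta> \<longleftrightarrow>
    (\<exists>\<tau> \<beta>\<^sub>0. lp_isometry q r n \<tau> \<and> \<beta>\<^sub>0 \<in> carrier_mat n n \<and> \<beta> = \<tau> * \<beta>\<^sub>0)"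

text \<open>Since \<open>n \<le> r\<close>, full rank of an \<open>r \<times> n\<close> matrix means rank \<open>n\<close>.\<close>

definition full_rank_polar :: "real \<Rightarrow> nat \<Rightarrow> nat \<Rightarrow> complex mat set" where
  "full_rank_polar q r n =
    {\<beta> \<in> carrier_mat r n. n \<le> r \<and> vec_space.rank r \<beta> = n \<and> lp_polar_decomposable q r n \<beta>}"


section \<open>Matrices over a complex vector space\<close>

text \<open>Vector spaces are subspaces \<open>X\<close> of an ambient complex vector space with
  scalar multiplication \<open>smul\<close>.\<close>

definition mats_over :: "nat \<Rightarrow> nat \<Rightarrow> 'a set \<Rightarrow> 'a mat set" where
  "mats_over n m X = {u \<in> carrier_mat n m. \<forall>i<n. \<forall>j<m. u $$ (i, j) \<in> X}"

definition bimod_mult ::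
  "(complex \<Rightarrow> 'a::ab_group_add \<Rightarrow> 'a) \<Rightarrow> complex mat \<Rightarrow> 'a mat \<Rightarrow> complex mat \<Rightarrow> 'a mat" where
  "bimod_mult smul \<alpha> w \<beta> =
    mat (dim_row \<alpha>) (dim_col \<beta>)
      (\<lambda>(i, j). \<Sum>k<dim_row w. \<Sum>l<dim_col w. smul (\<alpha> $$ (i, k) * \<beta> $$ (l, j)) (w $$ (k, l)))"

definition dsum_mat :: "'a::zero mat \<Rightarrow> 'a mat \<Rightarrow> 'a mat" where
  "dsum_mat u v =
    four_block_mat u (0\<^sub>m (dim_row u) (dim_col v)) (0\<^sub>m (dim_row v) (dim_col u)) v"


section \<open>\<open>p\<close>-operator spaces\<close>

text \<open>The metric on \<open>X\<close> given by the norm on \<open>1 \<times> 1\<close> matrices. \<open>Metric_space\<close> requires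
  symmetry and nonnegativity on the whole type, hence the value \<open>0\<close> off \<open>X\<close>.\<close>

definition space_dist :: "'a::ab_group_add set \<Rightarrow> (nat \<Rightarrow> 'a mat \<Rightarrow> real) \<Rightarrow> 'a \<Rightarrow> 'a \<Rightarrow> real" where
  "space_dist X N x y = (if x \<in> X \<and> y \<in> X then N 1 (mat 1 1 (\<lambda>_. x - y)) else 0)"

text \<open>\<open>N n\<close> is the norm on the \<open>n \<times> n\<close> matrices over \<open>X\<close>; its values elsewhere, and
  \<open>N 0\<close>, are unconstrained.\<close>

locale p_operator_space = vector_space smul
  for smul :: "complex \<Rightarrow> 'a::ab_group_add \<Rightarrow> 'a" +
  fixes p :: real and X :: "'a set" and N :: "nat \<Rightarrow> 'a mat \<Rightarrow> real"
  assumes subspace_X: "subspace X"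
    and norm_nonneg: "\<lbrakk>1 \<le> n; u \<in> mats_over n n X\<rbrakk> \<Longrightarrow> 0 \<le> N n u"
    and norm_eq_0: "\<lbrakk>1 \<le> n; u \<in> mats_over n n X\<rbrakk> \<Longrightarrow> N n u = 0 \<longleftrightarrow> u = 0\<^sub>m n n"
    and norm_scale: "\<lbrakk>1 \<le> n; u \<in> mats_over n n X\<rbrakk> \<Longrightarrow> N n (map_mat (smul c) u) = cmod c * N n u"
    and norm_triangle:
      "\<lbrakk>1 \<le> n; u \<in> mats_over n n X; v \<in> mats_over n n X\<rbrakk> \<Longrightarrow> N n (u + v) \<le> N n u + N n v"
    and complete: "Metric_space.mcomplete X (space_dist X N)"
    and norm_dsum:
      "\<lbrakk>1 \<le> n; 1 \<le> m; u \<in> mats_over n n X; v \<in> mats_over m m X\<rbrakk>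
        \<Longrightarrow> N (n + m) (dsum_mat u v) = max (N n u) (N m v)"
    and norm_bimod_mult:
      "\<lbrakk>1 \<le> n; 1 \<le> m; u \<in> mats_over m m X; \<alpha> \<in> carrier_mat n m; \<beta> \<in> carrier_mat m n\<rbrakk>
        \<Longrightarrow> N n (bimod_mult smul \<alpha> u \<beta>) \<le> lp_opnorm p \<alpha> * N m u * lp_opnorm p \<beta>"
begin

lemma Metric_space_dist: "Metric_space X (space_dist X N)"
proof
  have mats: "mat 1 1 (\<lambda>_. x) \<in> mats_over 1 1 X" if "x \<in> X" for x
    using that by (auto simp: mats_over_def)
  have diff: "x - y \<in> X" if "x \<in> X" "y \<in> X" for x y
    using subspace_diff[OF subspace_X] that by blast
  show "0 \<le> space_dist X N x y" for x y
    using norm_nonneg[of 1] mats diff by (auto simp: space_dist_def)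
  show "space_dist X N x y = space_dist X N y x" for x y
  proof (cases "x \<in> X \<and> y \<in> X")
    case True
    have "mat 1 1 (\<lambda>_. y - x) = map_mat (smul (-1)) (mat 1 1 (\<lambda>_. x - y))"
      by (rule eq_matI) auto
    with True norm_scale[of 1 "mat 1 1 (\<lambda>_. x - y)" "-1"] mats diff
    show ?thesis by (auto simp: space_dist_def)
  qed (auto simp: space_dist_def)
  show "space_dist X N x y = 0 \<longleftrightarrow> x = y" if "x \<in> X" "y \<in> X" for x y
  proof -
    have "mat 1 1 (\<lambda>_. x - y) = 0\<^sub>m 1 1 \<longleftrightarrow> x = y"
      by (auto simp: mat_eq_iff)
    with norm_eq_0[of 1 "mat 1 1 (\<lambda>_. x - y)"] that mats diff
    show ?thesis by (auto simp: space_dist_def)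
  qed
  show "space_dist X N x z \<le> space_dist X N x y + space_dist X N y z"
    if "x \<in> X" "y \<in> X" "z \<in> X" for x y z
  proof -
    have "mat 1 1 (\<lambda>_. x - z) = mat 1 1 (\<lambda>_. x - y) + mat 1 1 (\<lambda>_. y - z)"
      by (rule eq_matI) auto
    with norm_triangle[of 1 "mat 1 1 (\<lambda>_. x - y)" "mat 1 1 (\<lambda>_. y - z)"] that mats diff
    show ?thesis by (auto simp: space_dist_def)
  qed
qed

end

definition p_operator_subspace ::
  "(complex \<Rightarrow> 'a::ab_group_add \<Rightarrow> 'a) \<Rightarrow> real \<Rightarrow> 'a set \<Rightarrow> (nat \<Rightarrow> 'a mat \<Rightarrow> real)
    \<Rightarrow> 'a set \<Rightarrow> (nat \<Rightarrow> 'a mat \<Rightarrow> real) \<Rightarrow> bool" where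
  "p_operator_subspace smul p V NV W NW \<longleftrightarrow>
    p_operator_space smul p V NV \<and> p_operator_space smul p W NW \<and>
    V \<subseteq> W \<and> closedin (Metric_space.mtopology W (space_dist W NW)) V \<and>
    (\<forall>n\<ge>1. \<forall>u\<in>mats_over n n V. NV n u = NW n u)"


section \<open>The norms on \<open>\<T>\<^sub>n(X)\<close>\<close>

text \<open>\<open>p'\<close> is the conjugate exponent of \<open>p\<close>.\<close>

definition trace_norm1 ::
  "(complex \<Rightarrow> 'a::ab_group_add \<Rightarrow> 'a) \<Rightarrow> real \<Rightarrow> real \<Rightarrow> 'a set \<Rightarrow> (nat \<Rightarrow> 'a mat \<Rightarrow> real)
    \<Rightarrow> nat \<Rightarrow> 'a mat \<Rightarrow> real" where
  "trace_norm1 smul p p' X N n v =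
    Inf {entry_norm p' \<alpha> * N r w * entry_norm p \<beta> | r \<alpha> w \<beta>.
      1 \<le> r \<and> \<alpha> \<in> carrier_mat n r \<and> \<beta> \<in> carrier_mat r n \<and> w \<in> mats_over r r X \<and>
      v = bimod_mult smul \<alpha> w \<beta>}"

definition trace_norm2 ::
  "(complex \<Rightarrow> 'a::ab_group_add \<Rightarrow> 'a) \<Rightarrow> real \<Rightarrow> real \<Rightarrow> 'a set \<Rightarrow> (nat \<Rightarrow> 'a mat \<Rightarrow> real)
    \<Rightarrow> nat \<Rightarrow> 'a mat \<Rightarrow> real" where
  "trace_norm2 smul p p' X N n v =
    Inf {entry_norm p' \<alpha> * N r w * entry_norm p \<beta> | r \<alpha> w \<beta>.
      1 \<le> r \<and> n \<le> r \<and> transpose_mat \<alpha> \<in> full_rank_polar p' r n \<and> \<beta> \<in> full_rank_polar p r n \<and>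
      w \<in> mats_over r r X \<and> v = bimod_mult smul \<alpha> w \<beta>}"

end

theory Submission
  imports Defs
begin

text \<open>For \<open>v\<close> over \<open>V\<close> only decompositions \<open>v = \<alpha> w \<beta>\<close> over \<open>W\<close> with \<open>\<beta> = \<tau> \<beta>\<^sub>0\<close> and
  \<open>\<alpha> = \<alpha>\<^sub>0\<^sup>T \<sigma>\<^sup>T\<close> polar of full rank matter. Since \<open>\<alpha>\<^sub>0\<close> and \<open>\<beta>\<^sub>0\<close> are then invertible,
  \<open>w\<^sub>0 = \<sigma>\<^sup>T w \<tau>\<close> can be recovered from \<open>v\<close>, so its entries lie in \<open>V\<close>. The isometries
  leave the entry norms of \<open>\<alpha>\<^sub>0\<close>, \<open>\<beta>\<^sub>0\<close> unchanged, and by duality \<open>\<sigma>\<^sup>T\<close> is a contraction, so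
  \<open>v = \<alpha>\<^sub>0\<^sup>T w\<^sub>0 \<beta>\<^sub>0\<close> is a decomposition over \<open>V\<close> of no larger cost.\<close>

section \<open>Isometries of \<open>\<ell>\<^sub>p\<close> spaces\<close>

text \<open>Raising to the power \<open>q\<close> strips the outer root, leaving sums that can be
  added up over the columns of a matrix.\<close>

lemma lp_isometry_sum:
  assumes iso: "lp_isometry q r n \<tau>" and q: "0 < q" and x: "x \<in> carrier_vec n"
  shows "(\<Sum>i<r. cmod ((\<tau> *\<^sub>v x) $ i) powr q) = (\<Sum>i<n. cmod (x $ i) powr q)"
proof -
  have \<tau>: "\<tau> \<in> carrier_mat r n" and "lp_norm q (\<tau> *\<^sub>v x) = lp_norm q x"
    using iso x by (auto simp: lp_isometry_def)
  then have "(\<Sum>i<r. cmod ((\<tau> *\<^sub>v x) $ i) powr q) powr (1 / q)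
      = (\<Sum>i<n. cmod (x $ i) powr q) powr (1 / q)"
    using x by (simp add: lp_norm_def)
  then have "((\<Sum>i<r. cmod ((\<tau> *\<^sub>v x) $ i) powr q) powr (1 / q)) powr q
      = ((\<Sum>i<n. cmod (x $ i) powr q) powr (1 / q)) powr q"
    by simp
  then show ?thesis
    using q by (simp add: powr_powr sum_nonneg)
qed

text \<open>The \<open>q\<close>-th power of \<open>entry_norm q\<close> is the sum over the columns
  of the \<open>q\<close>-th powers of their \<open>lp_norm q\<close>, and left multiplication by
  \<tau> acts on each column separately.\<close>

lemma entry_norm_isometry_mult:
  assumes iso: "lp_isometry q r n \<tau>" and q: "0 < q" and B: "B \<in> carrier_mat n m"
  shows "entry_norm q (\<tau> * B) = entry_norm q B"
proof -
  have \<tau>: "\<tau> \<in> carrier_mat r n"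
    using iso by (simp add: lp_isometry_def)
  have "(\<Sum>i<r. \<Sum>j<m. cmod ((\<tau> * B) $$ (i, j)) powr q)
      = (\<Sum>j<m. \<Sum>i<r. cmod ((\<tau> *\<^sub>v col B j) $ i) powr q)"
    using \<tau> B by (subst sum.swap) simp
  also have "\<dots> = (\<Sum>j<m. \<Sum>i<n. cmod (col B j $ i) powr q)"
    using B by (intro sum.cong refl lp_isometry_sum[OF iso q]) simp
  also have "\<dots> = (\<Sum>i<n. \<Sum>j<m. cmod (B $$ (i, j)) powr q)"
    using B by (subst sum.swap) simp
  finally show ?thesis
    using \<tau> B by (simp add: entry_norm_def)
qed

lemma entry_norm_transpose: "entry_norm q (transpose_mat A) = entry_norm q A"
proof -
  have "(\<Sum>i<dim_col A. \<Sum>j<dim_row A. cmod (transpose_mat A $$ (i, j)) powr q)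
      = (\<Sum>i<dim_col A. \<Sum>j<dim_row A. cmod (A $$ (j, i)) powr q)"
    by (intro sum.cong refl) simp
  also have "\<dots> = (\<Sum>j<dim_row A. \<Sum>i<dim_col A. cmod (A $$ (j, i)) powr q)"
    by (rule sum.swap)
  finally show ?thesis
    by (simp add: entry_norm_def)
qed

lemma entry_norm_nonneg: "0 \<le> entry_norm q A"
  by (simp add: entry_norm_def)

text \<open>A real supremum is informative only over a nonempty set that is bounded above: the zero
  vector gives a member with value 0, contractivity the bound 1.\<close>

lemma lp_opnorm_bounds:
  assumes "\<And>x. x \<in> carrier_vec (dim_col A) \<Longrightarrow> lp_norm p (A *\<^sub>v x) \<le> lp_norm p x"
  shows "0 \<le> lp_opnorm p A" and "lp_opnorm p A \<le> 1"
proof -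
  let ?B = "{x \<in> carrier_vec (dim_col A). lp_norm p x \<le> 1}"
  have zero: "0\<^sub>v (dim_col A) \<in> ?B"
    by (simp add: lp_norm_def)
  have le: "lp_norm p (A *\<^sub>v x) \<le> 1" if "x \<in> ?B" for x
    using assms[of x] that by simp
  have "lp_norm p (A *\<^sub>v 0\<^sub>v (dim_col A)) \<le> lp_opnorm p A"
    unfolding lp_opnorm_def by (rule cSUP_upper[OF zero]) (auto intro!: bdd_aboveI2 le)
  then show "0 \<le> lp_opnorm p A"
    using order_trans[of 0] by (simp add: lp_norm_def)
  show "lp_opnorm p A \<le> 1"
    unfolding lp_opnorm_def using zero le by (intro cSUP_least) blast+
qed

text \<open>The transpose is the adjoint of \<sigma> for the bilinear duality of the
  \<open>p\<close> and \<open>p'\<close> norms, so its norm cannot exceed that of \<sigma>. The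
  proof tests the image of \<open>x\<close> against a vector that norms it.\<close>

lemma lp_isometry_transpose_contraction:
  assumes iso: "lp_isometry p' r n \<sigma>"
    and p: "1 < p" "1 < p'" "1 / p + 1 / p' = 1"
    and x: "x \<in> carrier_vec r"
  shows "lp_norm p (transpose_mat \<sigma> *\<^sub>v x) \<le> lp_norm p x"
proof -
  have \<sigma>: "\<sigma> \<in> carrier_mat r n"
    using iso by (simp add: lp_isometry_def)
  define y where "y = transpose_mat \<sigma> *\<^sub>v x"
  \<comment> \<open>\<open>z\<close> is the vector for which Hoelder's inequality against \<open>y\<close> is an equality.\<close>
  define z where "z = vec n (\<lambda>i. cnj (y $ i) * of_real (cmod (y $ i) powr (p - 2)))"
  define u where "u = \<sigma> *\<^sub>v z"
  define S where "S = (\<Sum>i<n. cmod (y $ i) powr p)"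
  have S_nonneg: "0 \<le> S"
    by (simp add: S_def sum_nonneg)
  have y: "y \<in> carrier_vec n" and z: "z \<in> carrier_vec n" and u: "u \<in> carrier_vec r"
    using \<sigma> x by (auto simp: y_def z_def u_def intro!: mult_mat_vec_carrier[of _ _ r])
  \<comment> \<open>The entries satisfy |z_i| = |y_i|^(p-1), so conjugacy of the exponents gives
    |z_i|^p' = |y_i|^p.\<close>
  have pp': "(p - 1) * p' = p"
    using p by (simp add: field_simps)
  have yz: "y $ i * z $ i = of_real (cmod (y $ i) powr p)" if "i < n" for i
  proof (cases "y $ i = 0")
    case False
    have "y $ i * z $ i = y $ i * cnj (y $ i) * of_real (cmod (y $ i) powr (p - 2))"
      using that by (simp add: z_def)
    also have "\<dots> = of_real (cmod (y $ i) powr 2 * cmod (y $ i) powr (p - 2))"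
      using False by (simp only: complex_norm_square[symmetric] of_real_mult) simp
    also have "cmod (y $ i) powr 2 * cmod (y $ i) powr (p - 2) = cmod (y $ i) powr p"
      by (subst powr_add[symmetric]) simp
    finally show ?thesis .
  qed simp
  have zp: "cmod (z $ i) powr p' = cmod (y $ i) powr p" if "i < n" for i
  proof (cases "y $ i = 0")
    case False
    have "cmod (z $ i) = cmod (y $ i) powr 1 * cmod (y $ i) powr (p - 2)"
      using that False by (simp add: z_def norm_mult)
    also have "\<dots> = cmod (y $ i) powr (p - 1)"
      by (subst powr_add[symmetric]) simp
    finally show ?thesis
      by (simp add: powr_powr pp')
  qed (use that in \<open>simp add: z_def\<close>)
  have u_sum: "(\<Sum>k<r. cmod (u $ k) powr p') = S"
    using lp_isometry_sum[OF iso _ z] p zp by (simp add: u_def S_def)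
  \<comment> \<open>The chain moves \<sigma> across the bilinear pairing, from \<open>y\<close> on
    the left to \<open>u\<close> on the right.\<close>
  have "complex_of_real S = (\<Sum>i<n. y $ i * z $ i)"
    by (simp add: S_def yz)
  also have "\<dots> = (\<Sum>i<n. \<Sum>k<r. \<sigma> $$ (k, i) * x $ k * z $ i)"
    using \<sigma> x by (intro sum.cong refl)
      (simp add: y_def scalar_prod_def sum_distrib_right atLeast0LessThan)
  also have "\<dots> = (\<Sum>k<r. \<Sum>i<n. \<sigma> $$ (k, i) * x $ k * z $ i)"
    by (rule sum.swap)
  also have "\<dots> = (\<Sum>k<r. x $ k * u $ k)"
    using \<sigma> z by (intro sum.cong refl)
      (simp add: u_def scalar_prod_def sum_distrib_left atLeast0LessThan mult_ac)
  finally have "S = cmod (\<Sum>k<r. x $ k * u $ k)"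
    using S_nonneg by (metis norm_of_real abs_of_nonneg)
  also have "\<dots> \<le> (\<Sum>k<r. cmod (x $ k) * cmod (u $ k))"
    by (rule order_trans[OF norm_sum]) (simp add: norm_mult)
  \<comment> \<open>Termwise Young can replace Hoelder here: the \<open>p'\<close>-sum of
    \<open>u\<close> is again \<open>S\<close>, so the resulting \<open>S / p'\<close> is absorbed
    on the left and \<open>S / p\<close> remains.\<close>
  also have "\<dots> \<le> (\<Sum>k<r. cmod (x $ k) powr p / p + cmod (u $ k) powr p' / p')"
    using p by (intro sum_mono Youngs_inequality) auto
  also have "\<dots> = (\<Sum>k<r. cmod (x $ k) powr p) / p + S / p'"
    by (simp add: sum.distrib u_sum flip: sum_divide_distrib)
  finally have "S * (1 - 1 / p') \<le> (\<Sum>k<r. cmod (x $ k) powr p) / p"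
    by (simp add: algebra_simps)
  moreover have pp'': "1 - 1 / p' = 1 / p"
    using p(3) by linarith
  ultimately have "S / p \<le> (\<Sum>k<r. cmod (x $ k) powr p) / p"
    by (simp only: pp'' times_divide_eq_right mult_1_right)
  then have "S \<le> (\<Sum>k<r. cmod (x $ k) powr p)"
    using p(1) by (simp add: divide_le_cancel)
  then show ?thesis
    using y x p unfolding y_def[symmetric] lp_norm_def
    by (intro powr_mono2) (auto simp: S_def sum_nonneg)
qed

section \<open>Polar decompositions of full rank\<close>

text \<open>A nonzero kernel vector is a linear dependence among the columns. As independence
  concerns the set of columns, repetitions must be excluded first: they would leave fewer than
  \<open>nc\<close> distinct columns and lower the rank.\<close>

lemma (in vec_space) full_rank_kernel:
  assumes A: "A \<in> carrier_mat n nc" and rank: "rank A = nc"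
    and v: "v \<in> carrier_vec nc" "A *\<^sub>v v = 0\<^sub>v n"
  shows "v = 0\<^sub>v nc"
proof -
  have "distinct (cols A)"
  proof (rule ccontr)
    assume nd: "\<not> distinct (cols A)"
    obtain S where S: "maximal S (\<lambda>T. T \<subseteq> set (cols A) \<and> lin_indpt T)"
      using maximal_exists_superset[of "set (cols A)" "\<lambda>T. T \<subseteq> set (cols A) \<and> lin_indpt T" "{}"]
      by (auto simp: lin_dep_def)
    then have "card S \<le> card (set (cols A))"
      by (intro card_mono) (auto simp: maximal_def)
    also have "\<dots> < length (cols A)"
      using nd card_distinct[of "cols A"] card_length[of "cols A"] by linarith
    finally show False
      using rank_card_indpt[OF A S] rank A by simp
  qed
  with full_rank_lin_indpt[OF A rank] lin_depI[OF A v(1) _ v(2)] show ?thesis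
    by blast
qed

text \<open>The kernel of \<open>\<beta>\<^sub>0\<close> lies in that of \<beta>, which full rank
  makes trivial; hence the square factor has an inverse \<gamma>.\<close>

lemma full_rank_polarE:
  assumes "\<beta> \<in> full_rank_polar q r n"
  obtains \<tau> \<beta>\<^sub>0 \<gamma> where "lp_isometry q r n \<tau>" "\<beta>\<^sub>0 \<in> carrier_mat n n" "\<beta> = \<tau> * \<beta>\<^sub>0"
    "\<gamma> \<in> carrier_mat n n" "\<beta>\<^sub>0 * \<gamma> = 1\<^sub>m n" "\<gamma> * \<beta>\<^sub>0 = 1\<^sub>m n"
proof -
  from assms obtain \<tau> \<beta>\<^sub>0 where \<beta>: "\<beta> \<in> carrier_mat r n" and rank: "vec_space.rank r \<beta> = n"
    and iso: "lp_isometry q r n \<tau>" and \<beta>\<^sub>0: "\<beta>\<^sub>0 \<in> carrier_mat n n" and eq: "\<beta> = \<tau> * \<beta>\<^sub>0"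
    by (auto simp: full_rank_polar_def lp_polar_decomposable_def)
  have \<tau>: "\<tau> \<in> carrier_mat r n"
    using iso by (simp add: lp_isometry_def)
  have "det \<beta>\<^sub>0 \<noteq> 0"
  proof
    assume "det \<beta>\<^sub>0 = 0"
    then obtain v where v: "v \<in> carrier_vec n" "v \<noteq> 0\<^sub>v n" "\<beta>\<^sub>0 *\<^sub>v v = 0\<^sub>v n"
      using det_0_iff_vec_prod_zero_field[OF \<beta>\<^sub>0] by blast
    have "\<beta> *\<^sub>v v = \<tau> *\<^sub>v 0\<^sub>v n"
      unfolding eq using assoc_mult_mat_vec[OF \<tau> \<beta>\<^sub>0 v(1)] v(3) by simp
    also have "\<dots> = 0\<^sub>v r"
      using \<tau> by auto
    finally show False
      using vec_space.full_rank_kernel[OF \<beta> rank v(1)] v(2) by blast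
  qed
  from det_non_zero_imp_unit[OF \<beta>\<^sub>0 this] obtain \<gamma>
    where "\<gamma> \<in> carrier_mat n n" "\<gamma> * \<beta>\<^sub>0 = 1\<^sub>m n" "\<beta>\<^sub>0 * \<gamma> = 1\<^sub>m n"
    by (auto simp: Units_def ring_mat_def)
  with that iso \<beta>\<^sub>0 eq show thesis
    by blast
qed

text \<open>This keeps the infimum in \<open>trace_norm2\<close> from ranging over the empty
  set.\<close>

lemma one_mat_full_rank_polar: "1\<^sub>m n \<in> full_rank_polar q n n"
proof -
  have "vec_space.rank n (1\<^sub>m n :: complex mat) = n"
    using vec_space.low_rank_det_zero[of "1\<^sub>m n" n] by simp
  moreover have "lp_polar_decomposable q n n (1\<^sub>m n)"
    unfolding lp_polar_decomposable_def lp_isometry_def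
    by (intro exI[of _ "1\<^sub>m n"]) auto
  ultimately show ?thesis
    by (simp add: full_rank_polar_def)
qed

section \<open>Bimodule action of scalar matrices\<close>

context
  fixes smul :: "complex \<Rightarrow> 'a::ab_group_add \<Rightarrow> 'a"
  assumes vector_space_smul: "vector_space smul"
begin

interpretation vector_space smul
  by (rule vector_space_smul)

lemma bimod_mult_assoc:
  assumes A: "A \<in> carrier_mat m n" and B: "B \<in> carrier_mat n r" and w: "w \<in> carrier_mat r s"
    and C: "C \<in> carrier_mat s k" and D: "D \<in> carrier_mat k l"
  shows "bimod_mult smul A (bimod_mult smul B w C) D = bimod_mult smul (A * B) w (C * D)"
proof (rule eq_matI)
  show "dim_row (bimod_mult smul A (bimod_mult smul B w C) D)
      = dim_row (bimod_mult smul (A * B) w (C * D))"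
    and "dim_col (bimod_mult smul A (bimod_mult smul B w C) D)
      = dim_col (bimod_mult smul (A * B) w (C * D))"
    by (simp_all add: bimod_mult_def)
next
  fix i j
  assume "i < dim_row (bimod_mult smul (A * B) w (C * D))"
    and "j < dim_col (bimod_mult smul (A * B) w (C * D))"
  then have i: "i < m" and j: "j < l"
    using A D by (simp_all add: bimod_mult_def)
  let ?t = "\<lambda>a b c d. smul (A $$ (i, a) * B $$ (a, c) * (C $$ (d, b) * D $$ (b, j))) (w $$ (c, d))"
  have "bimod_mult smul A (bimod_mult smul B w C) D $$ (i, j)
      = (\<Sum>a<n. \<Sum>b<k. \<Sum>c<r. \<Sum>d<s. ?t a b c d)"
    using A B w C D i j by (simp add: bimod_mult_def scale_sum_right mult_ac)
  \<comment> \<open>The swaps bring the sums over \<open>a\<close> and \<open>b\<close> innermost,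
    where they form the entries of \<open>A * B\<close> and \<open>C * D\<close>.\<close>
  also have "\<dots> = (\<Sum>a<n. \<Sum>c<r. \<Sum>b<k. \<Sum>d<s. ?t a b c d)"
    by (intro sum.cong refl sum.swap)
  also have "\<dots> = (\<Sum>c<r. \<Sum>a<n. \<Sum>b<k. \<Sum>d<s. ?t a b c d)"
    by (rule sum.swap)
  also have "\<dots> = (\<Sum>c<r. \<Sum>a<n. \<Sum>d<s. \<Sum>b<k. ?t a b c d)"
    by (intro sum.cong refl sum.swap)
  also have "\<dots> = (\<Sum>c<r. \<Sum>d<s. \<Sum>a<n. \<Sum>b<k. ?t a b c d)"
    by (intro sum.cong refl sum.swap)
  also have "\<dots> = bimod_mult smul (A * B) w (C * D) $$ (i, j)"
    using A B w C D i j
    by (simp add: bimod_mult_def scalar_prod_def atLeast0LessThan sum_product scale_sum_left)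
  finally show "bimod_mult smul A (bimod_mult smul B w C) D $$ (i, j)
      = bimod_mult smul (A * B) w (C * D) $$ (i, j)" .
qed

lemma bimod_mult_one:
  assumes w: "w \<in> carrier_mat n m"
  shows "bimod_mult smul (1\<^sub>m n) w (1\<^sub>m m) = w"
proof (rule eq_matI)
  fix i j
  assume "i < dim_row w" "j < dim_col w"
  then have i: "i < n" and j: "j < m"
    using w by auto
  have "bimod_mult smul (1\<^sub>m n) w (1\<^sub>m m) $$ (i, j)
      = (\<Sum>k<n. \<Sum>l<m. smul (1\<^sub>m n $$ (i, k) * 1\<^sub>m m $$ (l, j)) (w $$ (k, l)))"
    using w i j by (simp add: bimod_mult_def del: index_one_mat(1))
  also have "\<dots> = (\<Sum>k<n. \<Sum>l<m. if l = j then if k = i then w $$ (k, l) else 0 else 0)"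
    using i j by (intro sum.cong refl) auto
  also have "\<dots> = w $$ (i, j)"
    using i j by simp
  finally show "bimod_mult smul (1\<^sub>m n) w (1\<^sub>m m) $$ (i, j) = w $$ (i, j)" .
qed (use w in \<open>auto simp: bimod_mult_def\<close>)

lemma bimod_mult_mats_over:
  assumes "subspace X" and "w \<in> mats_over r s X"
    and "A \<in> carrier_mat n r" and "B \<in> carrier_mat s m"
  shows "bimod_mult smul A w B \<in> mats_over n m X"
  using assms by (auto simp: mats_over_def bimod_mult_def intro!: subspace_sum subspace_scale)

end

section \<open>The trace norms\<close>

context p_operator_space
begin

lemma trace_norm1_le:
  assumes "1 \<le> r" "\<alpha> \<in> carrier_mat n r" "\<beta> \<in> carrier_mat r n" "w \<in> mats_over r r X"
    "v = bimod_mult smul \<alpha> w \<beta>"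
  shows "trace_norm1 smul p p' X N n v \<le> entry_norm p' \<alpha> * N r w * entry_norm p \<beta>"
  unfolding trace_norm1_def
proof (rule cInf_lower)
  show "bdd_below {entry_norm p' \<alpha> * N r w * entry_norm p \<beta> | r \<alpha> w \<beta>.
      1 \<le> r \<and> \<alpha> \<in> carrier_mat n r \<and> \<beta> \<in> carrier_mat r n \<and> w \<in> mats_over r r X \<and>
      v = bimod_mult smul \<alpha> w \<beta>}"
    by (rule bdd_belowI[of _ 0]) (auto intro!: mult_nonneg_nonneg entry_norm_nonneg norm_nonneg)
qed (use assms in blast)

text \<open>A lower bound passes to a real infimum only over a nonempty set; factoring
  \<open>v\<close> through identity matrices provides a member.\<close>

lemma le_trace_norm1:
  assumes n: "1 \<le> n" and v: "v \<in> mats_over n n X"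
    and le: "\<And>r \<alpha> w \<beta>. \<lbrakk>1 \<le> r; \<alpha> \<in> carrier_mat n r; \<beta> \<in> carrier_mat r n;
        w \<in> mats_over r r X; v = bimod_mult smul \<alpha> w \<beta>\<rbrakk>
      \<Longrightarrow> c \<le> entry_norm p' \<alpha> * N r w * entry_norm p \<beta>"
  shows "c \<le> trace_norm1 smul p p' X N n v"
proof -
  have "v = bimod_mult smul (1\<^sub>m n) v (1\<^sub>m n)"
    using v by (simp add: bimod_mult_one[OF vector_space_axioms] mats_over_def)
  then show ?thesis
    unfolding trace_norm1_def using n v le by (intro cInf_greatest) (blast intro: one_carrier_mat)+
qed

lemma le_trace_norm2:
  assumes n: "1 \<le> n" and v: "v \<in> mats_over n n X"
    and le: "\<And>r \<alpha> w \<beta>. \<lbrakk>1 \<le> r; transpose_mat \<alpha> \<in> full_rank_polar p' r n; \<beta> \<in> full_rank_polar p r n;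
        w \<in> mats_over r r X; v = bimod_mult smul \<alpha> w \<beta>\<rbrakk>
      \<Longrightarrow> c \<le> entry_norm p' \<alpha> * N r w * entry_norm p \<beta>"
  shows "c \<le> trace_norm2 smul p p' X N n v"
proof -
  have "v = bimod_mult smul (1\<^sub>m n) v (1\<^sub>m n)" "transpose_mat (1\<^sub>m n) \<in> full_rank_polar p' n n"
    using v by (simp_all add: bimod_mult_one[OF vector_space_axioms] mats_over_def one_mat_full_rank_polar)
  then show ?thesis
    unfolding trace_norm2_def using n v le
    by (intro cInf_greatest) (blast intro: one_mat_full_rank_polar)+
qed

text \<open>Both outer factors are contractions for the exponent \<open>p\<close>: \<tau> as an
  isometry, the transpose of \<sigma> by duality.\<close>

lemma norm_isometry_mult:
  assumes n: "1 \<le> n" and r: "1 \<le> r" and w: "w \<in> mats_over r r X"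
    and p: "1 < p" "1 < p'" "1 / p + 1 / p' = 1"
    and \<sigma>: "lp_isometry p' r n \<sigma>" and \<tau>: "lp_isometry p r n \<tau>"
  shows "N n (bimod_mult smul (transpose_mat \<sigma>) w \<tau>) \<le> N r w"
proof -
  have carrier: "\<sigma> \<in> carrier_mat r n" "\<tau> \<in> carrier_mat r n"
    using \<sigma> \<tau> by (simp_all add: lp_isometry_def)
  have bd_\<tau>: "0 \<le> lp_opnorm p \<tau>" "lp_opnorm p \<tau> \<le> 1"
    using \<tau> by (auto simp: lp_isometry_def intro!: lp_opnorm_bounds)
  have bd_\<sigma>: "lp_opnorm p (transpose_mat \<sigma>) \<le> 1"
    using carrier by (intro lp_opnorm_bounds lp_isometry_transpose_contraction[OF \<sigma> p]) simp
  have "N n (bimod_mult smul (transpose_mat \<sigma>) w \<tau>)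
      \<le> lp_opnorm p (transpose_mat \<sigma>) * N r w * lp_opnorm p \<tau>"
    using carrier by (intro norm_bimod_mult n r w) auto
  also have "\<dots> \<le> 1 * N r w * 1"
    using bd_\<tau> bd_\<sigma> norm_nonneg[OF r w] by (intro mult_mono) auto
  finally show ?thesis
    by simp
qed

end

theorem proposition4p5:
  fixes smul :: "complex \<Rightarrow> 'a::ab_group_add \<Rightarrow> 'a"
    and p p' :: real and n :: nat
    and V W :: "'a set" and NV NW :: "nat \<Rightarrow> 'a mat \<Rightarrow> real"
  assumes "1 < p" and "1 < p'" and "1 / p + 1 / p' = 1"
    and "1 \<le> n"
    and "p_operator_subspace smul p V NV W NW"
    and "\<forall>w\<in>mats_over n n W.
      trace_norm2 smul p p' W NW n w = trace_norm1 smul p p' W NW n w"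
  shows "\<forall>v\<in>mats_over n n V.
      trace_norm1 smul p p' W NW n v = trace_norm1 smul p p' V NV n v"
proof (intro ballI antisym)
  note p = assms(1-3) and n = assms(4)
  from assms(5) interpret V: p_operator_space smul p V NV
    by (simp add: p_operator_subspace_def)
  from assms(5) interpret W: p_operator_space smul p W NW
    by (simp add: p_operator_subspace_def)
  have mats_sub: "mats_over m m V \<subseteq> mats_over m m W" for m
    using assms(5) by (auto simp: p_operator_subspace_def mats_over_def)
  have N_eq: "NV m u = NW m u" if "1 \<le> m" "u \<in> mats_over m m V" for m u
    using assms(5) that by (simp add: p_operator_subspace_def)
  fix v
  assume v: "v \<in> mats_over n n V"
  then have vW: "v \<in> mats_over n n W"
    using mats_sub by blast
  \<comment> \<open>A decomposition over \<open>V\<close> is one over \<open>W\<close> at the same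
    cost, so the infimum over \<open>W\<close> is no larger.\<close>
  show "trace_norm1 smul p p' W NW n v \<le> trace_norm1 smul p p' V NV n v"
    using mats_sub by (intro V.le_trace_norm1[OF n v]) (auto simp: N_eq intro!: W.trace_norm1_le)
  have "trace_norm1 smul p p' V NV n v \<le> trace_norm2 smul p p' W NW n v"
  proof (rule W.le_trace_norm2[OF n vW])
    fix r \<alpha> w \<beta>
    assume r: "1 \<le> r" and \<alpha>: "transpose_mat \<alpha> \<in> full_rank_polar p' r n"
      and \<beta>: "\<beta> \<in> full_rank_polar p r n" and w: "w \<in> mats_over r r W"
      and v_eq: "v = bimod_mult smul \<alpha> w \<beta>"
    from \<beta> obtain \<tau> \<beta>\<^sub>0 \<gamma> where \<tau>: "lp_isometry p r n \<tau>" and \<beta>\<^sub>0: "\<beta>\<^sub>0 \<in> carrier_mat n n"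
      and \<beta>_eq: "\<beta> = \<tau> * \<beta>\<^sub>0" and \<gamma>: "\<gamma> \<in> carrier_mat n n" "\<beta>\<^sub>0 * \<gamma> = 1\<^sub>m n" "\<gamma> * \<beta>\<^sub>0 = 1\<^sub>m n"
      by (rule full_rank_polarE)
    from \<alpha> obtain \<sigma> \<alpha>\<^sub>0 \<delta> where \<sigma>: "lp_isometry p' r n \<sigma>" and \<alpha>\<^sub>0: "\<alpha>\<^sub>0 \<in> carrier_mat n n"
      and \<alpha>_eq: "transpose_mat \<alpha> = \<sigma> * \<alpha>\<^sub>0"
      and \<delta>: "\<delta> \<in> carrier_mat n n" "\<alpha>\<^sub>0 * \<delta> = 1\<^sub>m n" "\<delta> * \<alpha>\<^sub>0 = 1\<^sub>m n"
      by (rule full_rank_polarE)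
    have carrier: "\<sigma> \<in> carrier_mat r n" "\<tau> \<in> carrier_mat r n" "w \<in> carrier_mat r r"
      "v \<in> carrier_mat n n"
      using \<sigma> \<tau> w v by (simp_all add: lp_isometry_def mats_over_def)
    have \<alpha>_eq': "\<alpha> = transpose_mat \<alpha>\<^sub>0 * transpose_mat \<sigma>"
      using arg_cong[OF \<alpha>_eq, of transpose_mat] carrier \<alpha>\<^sub>0 by (simp add: transpose_mult)
    have \<delta>': "transpose_mat \<delta> * transpose_mat \<alpha>\<^sub>0 = 1\<^sub>m n"
      "transpose_mat \<alpha>\<^sub>0 * transpose_mat \<delta> = 1\<^sub>m n"
      using \<delta> \<alpha>\<^sub>0 by (simp_all flip: transpose_mult)
    define w\<^sub>0 where "w\<^sub>0 = bimod_mult smul (transpose_mat \<sigma>) w \<tau>"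
    have w\<^sub>0: "w\<^sub>0 \<in> carrier_mat n n"
      using carrier by (simp add: w\<^sub>0_def bimod_mult_def)
    have v_eq': "v = bimod_mult smul (transpose_mat \<alpha>\<^sub>0) w\<^sub>0 \<beta>\<^sub>0"
      unfolding v_eq w\<^sub>0_def \<alpha>_eq' \<beta>_eq
      using carrier \<alpha>\<^sub>0 \<beta>\<^sub>0 by (subst bimod_mult_assoc[OF V.vector_space_axioms]) auto
    have "bimod_mult smul (transpose_mat \<delta>) v \<gamma> = w\<^sub>0"
      unfolding v_eq' using w\<^sub>0 \<alpha>\<^sub>0 \<beta>\<^sub>0 \<delta>(1) \<gamma>(1)
      by (subst bimod_mult_assoc[OF V.vector_space_axioms, where l = n]) (auto simp: \<delta>' \<gamma> bimod_mult_one[OF V.vector_space_axioms])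
    \<comment> \<open>Although built from \<open>w\<close> over \<open>W\<close>,
      \<open>w\<^sub>0\<close> is also a scalar multiple of \<open>v\<close> on both sides by
      matrices, and the subspace \<open>V\<close> is closed under these.\<close>
    then have w\<^sub>0V: "w\<^sub>0 \<in> mats_over n n V"
      using bimod_mult_mats_over[OF V.vector_space_axioms V.subspace_X v, of "transpose_mat \<delta>" n \<gamma> n] \<delta>(1) \<gamma>(1)
      by simp
    have "trace_norm1 smul p p' V NV n v
        \<le> entry_norm p' (transpose_mat \<alpha>\<^sub>0) * NV n w\<^sub>0 * entry_norm p \<beta>\<^sub>0"
      using \<alpha>\<^sub>0 \<beta>\<^sub>0 by (intro V.trace_norm1_le n w\<^sub>0V v_eq') auto
    also have "NV n w\<^sub>0 = NW n w\<^sub>0"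
      by (rule N_eq[OF n w\<^sub>0V])
    also have "entry_norm p' (transpose_mat \<alpha>\<^sub>0) = entry_norm p' \<alpha>"
      using entry_norm_isometry_mult[OF \<sigma> _ \<alpha>\<^sub>0] p
      by (simp add: entry_norm_transpose flip: \<alpha>_eq)
    also have "entry_norm p \<beta>\<^sub>0 = entry_norm p \<beta>"
      using entry_norm_isometry_mult[OF \<tau> _ \<beta>\<^sub>0] p by (simp add: \<beta>_eq)
    also have "entry_norm p' \<alpha> * NW n w\<^sub>0 * entry_norm p \<beta> \<le> entry_norm p' \<alpha> * NW r w * entry_norm p \<beta>"
      unfolding w\<^sub>0_def
      by (intro mult_right_mono mult_left_mono entry_norm_nonneg W.norm_isometry_mult[OF n r w p \<sigma> \<tau>])
    finally show "trace_norm1 smul p p' V NV n v \<le> entry_norm p' \<alpha> * NW r w * entry_norm p \<beta>" .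
  qed
  \<comment> \<open>The assumed equality of the two norms over \<open>W\<close>, taken at
    \<open>v\<close>, turns the bound by \<open>trace_norm2\<close> into one by
    \<open>trace_norm1\<close>.\<close>
  then show "trace_norm1 smul p p' V NV n v \<le> trace_norm1 smul p p' W NW n v"
    using assms(6) vW by simp
qed

end
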